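(* Let $N\ge1$ and let $M(t)=[m_{ij}(t)]_{i,j=1}^n$, $t=0,\dots,N-1$, be matrices with nonnegative entries such that the matrix $$G=M(0)M(1)\cdots M(N-2)M(N-1)=(g_{ij})$$ has all positive elements $g_{ij}$. Let $\nu_0$ and $\nu_N$ be any two probability distributions on $\mathcal X=\{1,\dots,n\}$. Then there exists a unique choice of the vectors $\varphi(0)=(\varphi(0,i))_{i\in\mathcal X}$ and $\hat\varphi(N)=(\hat\varphi(N,j))_{j\in\mathcal X}$ with positive entries such that the following system holds for functions $\varphi,\hat\varphi:\{0,1,\dots,N\}\times\mathcal X\to[0,\infty)$ having these values at $t=0$ and $t=N$, respectively: $$\varphi(t,i)=\sum_{j}m_{ij}(t)\,\varphi(t+1,j),\qquad 0\le t\le N-1,\ i\in\mathcal X,$$ $$\hat\varphi(t+1,j)=\sum_{i}m_{ij}(t)\,\hat\varphi(t,i),\qquad 0\le t\le N-1,\ j\in\mathcal X,$$ $$\varphi(0,x_0)\,\hat\varphi(0,x_0)=\nu_0(x_0),\qquad x_0\in\mathcal X,$$ $$\varphi(N,x_N)^2\,\hat\varphi(N,x_N)=\nu_N(x_N),\qquad x_N\in\mathcal X.$$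
   Context: $\mathcal X$ is the vertex set of a directed, strongly connected, aperiodic graph with edge set $\mathcal E\subseteq\mathcal X\times\mathcal X$, and $m_{ij}(t)=0$ whenever $(i,j)\notin\mathcal E$. The rows of $M(t)$ need not sum to one. $\nu_0$ and $\nu_N$ may have zero entries. *)

theory Defs
  imports "HOL-Probability.Probability"
begin

primrec matrix_chain_prod :: "(nat \<Rightarrow> real^'n^'n) \<Rightarrow> nat \<Rightarrow> real^'n^'n" where
  "matrix_chain_prod M 0 = mat 1"
| "matrix_chain_prod M (Suc k) = matrix_chain_prod M k ** M k"

text \<open>A directed graph, loops allowed, is given by its edge relation; the vertex set is the
  whole type.\<close>

definition strongly_connected_graph :: "('a \<times> 'a) set \<Rightarrow> bool" where
  "strongly_connected_graph E \<longleftrightarrow> (\<forall>i j. (i, j) \<in> E\<^sup>*)"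

text \<open>\<open>(i, i) \<in> E ^^ k\<close> says that there is a closed walk of length \<open>k\<close> at \<open>i\<close>; every closed walk
  splits into cycles, so this \<open>Gcd\<close> is also the gcd of all cycle lengths.\<close>

definition aperiodic_graph :: "('a \<times> 'a) set \<Rightarrow> bool" where
  "aperiodic_graph E \<longleftrightarrow> Gcd {k :: nat. 0 < k \<and> (\<exists>i. (i, i) \<in> E ^^ k)} = 1"

end

theory Submission
  imports Defs
begin

text \<open>
  Propagating \<open>\<phi>\<close> backwards and \<open>\<psi>\<close> forwards through the matrices removes all intermediate
  times: with \<open>G\<close> the product of the chain, \<open>\<phi> 0 = G (\<phi> N)\<close> and \<open>\<psi> N = (\<psi> 0) G\<close>. Given positive
  \<open>a = \<phi> 0\<close> and \<open>b = \<psi> N\<close>, the two marginal conditions determine the remaining boundary values,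
  \<open>\<psi> 0 = p / a\<close> and \<open>\<phi> N = \<surd>(q / b)\<close>, where \<open>p\<close> and \<open>q\<close> are the prescribed marginals. So the
  problem is the static system \<open>a = G \<surd>(q / b)\<close>, \<open>b = (p / a) G\<close>
  (\<open>schroedinger_boundary_reduction\<close>).

  Eliminating \<open>a\<close> makes \<open>b\<close> a fixed point of a map that is order preserving, being composed of two
  order reversing maps, and homogeneous of degree \<open>1/2\<close>, the exponent coming from the square in the
  terminal condition. If \<open>b \<le> exp d * b'\<close> entrywise, then the images compare with the
  factor \<open>exp (d / 2)\<close>. In the coordinates \<open>ln b\<close> the map is therefore a contraction with factor \<open>1/2\<close>
  for the maximum norm (this is the Thompson metric on the positive cone), and Banach's theorem gives
  existence and uniqueness at once (\<open>static_schroedinger_system\<close>). Zero entries of \<open>p\<close> and \<open>q\<close> do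
  no harm, because a positive matrix sends nonzero nonnegative vectors to positive ones.
\<close>

section \<open>Contractions for the maximum norm\<close>

text \<open>
  Completeness is available for the Euclidean norm, which is equivalent to the maximum norm up to a
  factor \<open>\<surd>DIM\<close>. A high iterate of the map contracts by more than this factor, so it is a Euclidean
  contraction, and the fixed point of an iterate is the fixed point of the map.
\<close>

lemma infnorm_contraction_fixpoint:
  fixes f :: "'a::euclidean_space \<Rightarrow> 'a"
  assumes c: "0 \<le> c" "c < 1"
    and contr: "\<And>x y. infnorm (f x - f y) \<le> c * infnorm (x - y)"
  shows "\<exists>!x. f x = x"
proof -
  have iter: "infnorm ((f ^^ k) x - (f ^^ k) y) \<le> c ^ k * infnorm (x - y)" for k x y
  proof (induction k)
    case (Suc k)
    have "infnorm ((f ^^ Suc k) x - (f ^^ Suc k) y) \<le> c * infnorm ((f ^^ k) x - (f ^^ k) y)"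
      using contr by simp
    also have "\<dots> \<le> c * (c ^ k * infnorm (x - y))"
      using Suc c(1) by (rule mult_left_mono)
    finally show ?case by (simp add: mult.assoc)
  qed simp
  let ?K = "sqrt DIM('a)"
  have K: "0 < ?K" by simp
  then obtain k where k: "c ^ k < 1 / (2 * ?K)"
    using c real_arch_pow_inv[of "1 / (2 * ?K)" c] by auto
  have "dist ((f ^^ k) x) ((f ^^ k) y) \<le> 1 / 2 * dist x y" for x y
  proof -
    have "dist ((f ^^ k) x) ((f ^^ k) y) \<le> ?K * infnorm ((f ^^ k) x - (f ^^ k) y)"
      unfolding dist_norm by (rule norm_le_infnorm)
    also have "\<dots> \<le> ?K * (c ^ k * infnorm (x - y))"
      using iter K by (intro mult_left_mono) auto
    also have "\<dots> \<le> ?K * (1 / (2 * ?K) * norm (x - y))"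
      using k K c infnorm_le_norm[of "x - y"] infnorm_pos_le[of "x - y"]
      by (intro mult_left_mono mult_mono) auto
    also have "\<dots> = 1 / 2 * dist x y"
      using K by (simp add: dist_norm)
    finally show ?thesis .
  qed
  then have "\<exists>!x. (f ^^ k) x = x"
    by (intro banach_fix_type[where c = "1 / 2"]) auto
  then obtain x where x: "(f ^^ k) x = x" and unique: "\<And>y. (f ^^ k) y = y \<Longrightarrow> y = x"
    by auto
  have "(f ^^ k) (f x) = f x"
    by (metis x funpow_swap1)
  then have "f x = x" by (rule unique)
  moreover have "y = x" if "f y = y" for y
  proof (rule unique)
    show "(f ^^ k) y = y" using that by (induction k) auto
  qed
  ultimately show ?thesis by blast
qed

lemma infnorm_le_cart:
  fixes x :: "real^'n::finite"
  assumes "\<And>i. \<bar>x $ i\<bar> \<le> r"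
  shows "infnorm x \<le> r"
  unfolding infnorm_Max using assms by (auto simp: Basis_vec_def inner_axis)

section \<open>The static system\<close>

lemma positive_matrix_vector_pos:
  fixes G :: "real^'n::finite^'m::finite"
  assumes "\<And>i j. 0 < G $ i $ j" "\<And>j. 0 \<le> v $ j" "v \<noteq> 0"
  shows "0 < (G *v v) $ i"
proof -
  obtain j where "v $ j \<noteq> 0" using assms(3) by (auto simp: vec_eq_iff)
  then have "0 < v $ j" using assms(2)[of j] by simp
  moreover have "0 \<le> G $ i $ k" for k using assms(1)[of i k] by simp
  ultimately show ?thesis
    unfolding matrix_vector_mult_def using assms(1,2)
    by (auto intro!: sum_pos2[of _ j])
qed

lemma nonneg_matrix_vector_mono:
  fixes G :: "real^'n::finite^'m::finite"
  assumes "\<And>i j. 0 \<le> G $ i $ j" "\<And>j. v $ j \<le> r * w $ j"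
  shows "(G *v v) $ i \<le> r * (G *v w) $ i"
proof -
  have "(G *v v) $ i \<le> (\<Sum>j\<in>UNIV. G $ i $ j * (r * w $ j))"
    unfolding matrix_vector_mult_def using assms by (auto intro!: sum_mono mult_left_mono)
  then show ?thesis
    by (simp add: matrix_vector_mult_def sum_distrib_left mult.left_commute)
qed

definition initial_from_terminal :: "real^'n^'m \<Rightarrow> real^'n \<Rightarrow> real^'n \<Rightarrow> real^'m" where
  "initial_from_terminal G q b = G *v (\<chi> j. sqrt (q $ j / b $ j))"

definition terminal_from_initial :: "real^'n^'m \<Rightarrow> real^'m \<Rightarrow> real^'m \<Rightarrow> real^'n" where
  "terminal_from_initial G p a = (\<chi> i. p $ i / a $ i) v* G"

lemma initial_from_terminal_pos:
  fixes G :: "real^'n::finite^'m::finite"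
  assumes "\<And>i j. 0 < G $ i $ j" "\<And>j. 0 \<le> q $ j" "q \<noteq> 0" "\<And>j. 0 < b $ j"
  shows "0 < initial_from_terminal G q b $ i"
proof -
  obtain j where "q $ j \<noteq> 0" using assms(3) by (auto simp: vec_eq_iff)
  moreover have "b $ j \<noteq> 0" using assms(4)[of j] by simp
  ultimately have "(\<chi> j. sqrt (q $ j / b $ j)) \<noteq> 0" by (auto simp: vec_eq_iff)
  then show ?thesis
    unfolding initial_from_terminal_def using assms
    by (intro positive_matrix_vector_pos) (auto intro!: divide_nonneg_pos)
qed

lemma terminal_from_initial_pos:
  fixes G :: "real^'n::finite^'m::finite"
  assumes "\<And>i j. 0 < G $ i $ j" "\<And>i. 0 \<le> p $ i" "p \<noteq> 0" "\<And>i. 0 < a $ i"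
  shows "0 < terminal_from_initial G p a $ j"
proof -
  obtain i where "p $ i \<noteq> 0" using assms(3) by (auto simp: vec_eq_iff)
  moreover have "a $ i \<noteq> 0" using assms(4)[of i] by simp
  ultimately have "(\<chi> i. p $ i / a $ i) \<noteq> 0" by (auto simp: vec_eq_iff)
  then have "0 < (transpose G *v (\<chi> i. p $ i / a $ i)) $ j"
    using assms by (intro positive_matrix_vector_pos) (auto simp: transpose_def intro!: divide_nonneg_pos)
  then show ?thesis by (simp add: terminal_from_initial_def)
qed

text \<open>The square root turns a comparison factor \<open>r\<close> into \<open>\<surd>r\<close>; this is where the contraction comes
  from.\<close>

lemma initial_from_terminal_antimono:
  fixes G :: "real^'n::finite^'m::finite"
  assumes "\<And>i j. 0 \<le> G $ i $ j" "\<And>j. 0 \<le> q $ j" "0 < r"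
    and "\<And>j. 0 < b $ j" "\<And>j. 0 < b' $ j" "\<And>j. b $ j \<le> r * b' $ j"
  shows "initial_from_terminal G q b' $ i \<le> sqrt r * initial_from_terminal G q b $ i"
  unfolding initial_from_terminal_def
proof (rule nonneg_matrix_vector_mono)
  fix j
  have "q $ j * b $ j \<le> q $ j * (r * b' $ j)"
    using assms(2,6) by (intro mult_left_mono) auto
  then have "q $ j / b' $ j \<le> r * (q $ j / b $ j)"
    using assms(4,5)[of j] by (simp add: field_simps)
  then show "(\<chi> j. sqrt (q $ j / b' $ j)) $ j \<le> sqrt r * (\<chi> j. sqrt (q $ j / b $ j)) $ j"
    by (simp add: real_sqrt_mult [symmetric])
qed (use assms in auto)

lemma terminal_from_initial_antimono:
  fixes G :: "real^'n::finite^'m::finite"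
  assumes "\<And>i j. 0 \<le> G $ i $ j" "\<And>i. 0 \<le> p $ i"
    and "\<And>i. 0 < a $ i" "\<And>i. 0 < a' $ i" "\<And>i. a $ i \<le> r * a' $ i"
  shows "terminal_from_initial G p a' $ j \<le> r * terminal_from_initial G p a $ j"
proof -
  have "(transpose G *v (\<chi> i. p $ i / a' $ i)) $ j \<le> r * (transpose G *v (\<chi> i. p $ i / a $ i)) $ j"
  proof (rule nonneg_matrix_vector_mono)
    fix i
    have "p $ i * a $ i \<le> p $ i * (r * a' $ i)"
      using assms(2,5) by (intro mult_left_mono) auto
    then show "(\<chi> i. p $ i / a' $ i) $ i \<le> r * (\<chi> i. p $ i / a $ i) $ i"
      using assms(3,4)[of i] by (simp add: field_simps)
  qed (use assms in \<open>auto simp: transpose_def\<close>)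
  then show ?thesis by (simp add: terminal_from_initial_def)
qed

text \<open>The map \<open>T\<close> is \<open>b \<mapsto> (p / G \<surd>(q / b)) G\<close>, and \<open>L\<close> is \<open>T\<close> in logarithmic coordinates, which
  turn the open positive cone into a complete space.\<close>

lemma static_schroedinger_system:
  fixes G :: "real^'n::finite^'m::finite"
  assumes G: "\<And>i j. 0 < G $ i $ j"
    and p: "\<And>i. 0 \<le> p $ i" "p \<noteq> 0"
    and q: "\<And>j. 0 \<le> q $ j" "q \<noteq> 0"
  shows "\<exists>!(a, b). (\<forall>i. 0 < a $ i) \<and> (\<forall>j. 0 < b $ j) \<and>
    a = initial_from_terminal G q b \<and> b = terminal_from_initial G p a"
proof -
  define T where "T b = terminal_from_initial G p (initial_from_terminal G q b)" for b
  define ex where "ex u = (\<chi> j. exp (u $ j))" for u :: "real^'n"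
  define L where "L u = (\<chi> j. ln (T (ex u) $ j))" for u
  have G0: "\<And>i j. 0 \<le> G $ i $ j" using G by (simp add: less_imp_le)
  have ex_pos: "0 < ex u $ j" for u j by (simp add: ex_def)
  have init_pos: "0 < initial_from_terminal G q b $ i" if "\<And>j. 0 < b $ j" for b i
    using initial_from_terminal_pos G q that by blast
  have T_pos: "0 < T b $ j" if "\<And>j. 0 < b $ j" for b j
    unfolding T_def using terminal_from_initial_pos G p init_pos that by blast
  \<comment> \<open>One-sided form of the contraction; applied in both directions it bounds the absolute value.\<close>
  have shift: "L u $ j \<le> L v $ j + d / 2" if "\<And>j. u $ j \<le> v $ j + d" for u v d j
  proof -
    have "ex u $ j \<le> exp d * ex v $ j" for j
      using that[of j] by (simp add: ex_def exp_add[symmetric] add.commute)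
    then have "initial_from_terminal G q (ex v) $ i
        \<le> sqrt (exp d) * initial_from_terminal G q (ex u) $ i" for i
      by (intro initial_from_terminal_antimono G0 q ex_pos) auto
    then have "T (ex u) $ j \<le> sqrt (exp d) * T (ex v) $ j"
      unfolding T_def by (intro terminal_from_initial_antimono G0 p init_pos ex_pos)
    moreover have "sqrt (exp d) = exp (d / 2)"
      by (rule real_sqrt_unique) (simp_all add: power2_eq_square exp_add[symmetric])
    ultimately have "T (ex u) $ j \<le> exp (d / 2) * T (ex v) $ j" by simp
    then have "ln (T (ex u) $ j) \<le> ln (exp (d / 2) * T (ex v) $ j)"
      using T_pos ex_pos by (subst ln_le_cancel_iff) auto
    then show ?thesis
      using T_pos[of "ex v" j] ex_pos by (simp add: L_def ln_mult)
  qed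
  have "infnorm (L u - L v) \<le> 1 / 2 * infnorm (u - v)" for u v
  proof (rule infnorm_le_cart)
    fix j
    have d: "\<bar>u $ j - v $ j\<bar> \<le> infnorm (u - v)" for j
      using component_le_infnorm_cart[of "u - v" j] by simp
    have "L u $ j \<le> L v $ j + infnorm (u - v) / 2"
      by (rule shift) (use d in \<open>smt (verit)\<close>)
    moreover have "L v $ j \<le> L u $ j + infnorm (u - v) / 2"
      by (rule shift) (use d in \<open>smt (verit)\<close>)
    ultimately show "\<bar>(L u - L v) $ j\<bar> \<le> 1 / 2 * infnorm (u - v)"
      unfolding vector_minus_component by linarith
  qed
  then have "\<exists>!u. L u = u"
    by (intro infnorm_contraction_fixpoint[where c = "1 / 2"]) auto
  then obtain u where u: "L u = u" and u_unique: "\<And>v. L v = v \<Longrightarrow> v = u" by auto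
  have exL: "ex (L v) = T (ex v)" for v
    using T_pos[of "ex v"] ex_pos by (simp add: vec_eq_iff ex_def L_def)
  show ?thesis
  proof (rule ex1I[where a = "(initial_from_terminal G q (ex u), ex u)"])
    show "case (initial_from_terminal G q (ex u), ex u) of (a, b) \<Rightarrow>
      (\<forall>i. 0 < a $ i) \<and> (\<forall>j. 0 < b $ j) \<and>
      a = initial_from_terminal G q b \<and> b = terminal_from_initial G p a"
      using init_pos[of "ex u"] ex_pos exL[of u] u by (simp add: T_def)
  next
    fix z :: "(real^'m) \<times> (real^'n)"
    assume z: "case z of (a, b) \<Rightarrow> (\<forall>i. 0 < a $ i) \<and> (\<forall>j. 0 < b $ j) \<and>
      a = initial_from_terminal G q b \<and> b = terminal_from_initial G p a"
    obtain a b where ab: "z = (a, b)" by force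
    define v where "v = (\<chi> j. ln (b $ j))"
    from z have pos: "\<And>j. 0 < b $ j" and a: "a = initial_from_terminal G q b"
      and "b = terminal_from_initial G p a"
      unfolding ab by blast+
    then have "T b = b" unfolding T_def by metis
    moreover have "ex v = b" using pos by (simp add: v_def ex_def vec_eq_iff)
    ultimately have b: "ex v = b" "T b = b" by auto
    then have "L v = v" by (simp add: L_def v_def)
    then have "b = ex u" using u_unique b(1) by metis
    then show "z = (initial_from_terminal G q (ex u), ex u)" using a ab by simp
  qed
qed

section \<open>Eliminating the intermediate times\<close>

lemma chain_forward:
  assumes "\<And>t. t < N \<Longrightarrow> \<psi> (Suc t) = \<psi> t v* M t" "t \<le> N"
  shows "\<psi> t = \<psi> 0 v* matrix_chain_prod M t"
  using assms(2) by (induction t) (auto simp: assms(1) vector_matrix_mul_assoc)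

lemma chain_backward:
  assumes "\<And>t. t < N \<Longrightarrow> \<phi> t = M t *v \<phi> (Suc t)" "t \<le> N"
  shows "\<phi> 0 = matrix_chain_prod M t *v \<phi> t"
  using assms(2) by (induction t) (auto simp: assms(1) matrix_vector_mul_assoc)

text \<open>The recursion for \<open>\<phi>\<close> runs from \<open>N\<close> down to \<open>0\<close>; the step number below counts the remaining
  time \<open>N - t\<close>.\<close>

lemma backward_solution_exists:
  fixes M :: "nat \<Rightarrow> real^'n::finite^'n"
  assumes "\<And>t i j. t < N \<Longrightarrow> 0 \<le> M t $ i $ j" "\<And>i. 0 \<le> v $ i"
  obtains \<phi> where "\<phi> N = v" "\<And>t. t < N \<Longrightarrow> \<phi> t = M t *v \<phi> (Suc t)"
    "\<And>t i. t \<le> N \<Longrightarrow> 0 \<le> \<phi> t $ i"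
proof -
  define R where "R = rec_nat v (\<lambda>s w. M (N - Suc s) *v w)"
  have nonneg: "0 \<le> R s $ i" if "s \<le> N" for s i
    using that
  proof (induction s arbitrary: i)
    case (Suc s)
    then show ?case
      using assms(1)[of "N - Suc s"]
      by (auto simp: R_def matrix_vector_mult_def intro!: sum_nonneg mult_nonneg_nonneg)
  qed (simp add: R_def assms(2))
  have "R (N - t) = M t *v R (N - Suc t)" if "t < N" for t
  proof -
    have "N - t = Suc (N - Suc t)" "N - Suc (N - Suc t) = t" using that by auto
    then show ?thesis by (simp add: R_def)
  qed
  then show ?thesis
    using nonneg by (intro that[of "\<lambda>t. R (N - t)"]) (auto simp: R_def)
qed

lemma forward_solution_exists:
  fixes M :: "nat \<Rightarrow> real^'n::finite^'n"
  assumes "\<And>t i j. t < N \<Longrightarrow> 0 \<le> M t $ i $ j" "\<And>i. 0 \<le> v $ i"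
  obtains \<psi> where "\<psi> 0 = v" "\<And>t. t < N \<Longrightarrow> \<psi> (Suc t) = \<psi> t v* M t"
    "\<And>t i. t \<le> N \<Longrightarrow> 0 \<le> \<psi> t $ i"
proof -
  define R where "R = rec_nat v (\<lambda>s w. w v* M s)"
  have "0 \<le> R s $ i" if "s \<le> N" for s i
    using that
  proof (induction s arbitrary: i)
    case (Suc s)
    then show ?case
      using assms(1)[of s]
      by (auto simp: R_def vector_matrix_mult_def intro!: sum_nonneg mult_nonneg_nonneg)
  qed (simp add: R_def assms(2))
  then show ?thesis by (intro that[of R]) (auto simp: R_def)
qed

text \<open>Since \<open>a\<close> and \<open>b\<close> are positive, the marginal conditions can be solved for \<open>\<psi> 0\<close> and \<open>\<phi> N\<close>; the
  second involves a square, and nonnegativity of \<open>\<phi> N\<close> selects the root.\<close>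

lemma schroedinger_boundary_reduction:
  fixes M :: "nat \<Rightarrow> real^'n::finite^'n"
  assumes M: "\<And>t i j. t < N \<Longrightarrow> 0 \<le> M t $ i $ j"
    and p: "\<And>i. 0 \<le> p $ i" and q: "\<And>j. 0 \<le> q $ j"
    and a: "\<And>i. 0 < a $ i" and b: "\<And>j. 0 < b $ j"
  shows "(\<exists>\<phi> \<psi> :: nat \<Rightarrow> real^'n.
      \<phi> 0 = a \<and> \<psi> N = b \<and>
      (\<forall>t\<le>N. \<forall>i. 0 \<le> \<phi> t $ i \<and> 0 \<le> \<psi> t $ i) \<and>
      (\<forall>t<N. \<forall>i. \<phi> t $ i = (\<Sum>j\<in>UNIV. M t $ i $ j * \<phi> (Suc t) $ j)) \<and>
      (\<forall>t<N. \<forall>j. \<psi> (Suc t) $ j = (\<Sum>i\<in>UNIV. M t $ i $ j * \<psi> t $ i)) \<and>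
      (\<forall>x. \<phi> 0 $ x * \<psi> 0 $ x = p $ x) \<and>
      (\<forall>x. (\<phi> N $ x)\<^sup>2 * \<psi> N $ x = q $ x)) \<longleftrightarrow>
    a = initial_from_terminal (matrix_chain_prod M N) q b \<and>
    b = terminal_from_initial (matrix_chain_prod M N) p a"
    (is "?dynamic \<longleftrightarrow> ?static")
proof
  assume ?dynamic
  then obtain \<phi> \<psi> :: "nat \<Rightarrow> real^'n" where
    ends: "\<phi> 0 = a" "\<psi> N = b"
    and nonneg: "\<And>i. 0 \<le> \<phi> N $ i"
    and \<phi>: "\<And>t. t < N \<Longrightarrow> \<phi> t = M t *v \<phi> (Suc t)"
    and \<psi>: "\<And>t. t < N \<Longrightarrow> \<psi> (Suc t) = \<psi> t v* M t"
    and marg0: "\<And>x. a $ x * \<psi> 0 $ x = p $ x"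
    and margN: "\<And>x. (\<phi> N $ x)\<^sup>2 * b $ x = q $ x"
    by (auto simp: vec_eq_iff matrix_vector_mult_def vector_matrix_mult_def mult.commute)
  have "\<psi> 0 $ x = p $ x / a $ x" for x
    using marg0[of x] a[of x] by (simp add: field_simps)
  then have \<psi>0: "\<psi> 0 = (\<chi> x. p $ x / a $ x)" by (simp add: vec_eq_iff)
  have "\<phi> N $ x = sqrt (q $ x / b $ x)" for x
  proof -
    have "(\<phi> N $ x)\<^sup>2 = q $ x / b $ x"
      using margN[of x] b[of x] by (simp add: field_simps)
    then show ?thesis using nonneg by (metis real_sqrt_unique)
  qed
  then have \<phi>N: "\<phi> N = (\<chi> x. sqrt (q $ x / b $ x))" by (simp add: vec_eq_iff)
  show ?static
    using chain_backward[of N \<phi> M N, OF \<phi>] chain_forward[of N \<psi> M N, OF \<psi>]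
    by (simp add: ends \<psi>0 \<phi>N initial_from_terminal_def terminal_from_initial_def)
next
  assume static: ?static
  have "\<And>x. 0 \<le> (\<chi> x. sqrt (q $ x / b $ x)) $ x"
    using q b by (simp add: less_imp_le)
  from backward_solution_exists[of N M, OF M this] obtain \<phi> where
    \<phi>N: "\<phi> N = (\<chi> x. sqrt (q $ x / b $ x))"
    and \<phi>: "\<And>t. t < N \<Longrightarrow> \<phi> t = M t *v \<phi> (Suc t)" "\<And>t i. t \<le> N \<Longrightarrow> 0 \<le> \<phi> t $ i"
    by blast
  have "\<And>x. 0 \<le> (\<chi> x. p $ x / a $ x) $ x"
    using p a by (simp add: less_imp_le)
  from forward_solution_exists[of N M, OF M this] obtain \<psi> where
    \<psi>0: "\<psi> 0 = (\<chi> x. p $ x / a $ x)"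
    and \<psi>: "\<And>t. t < N \<Longrightarrow> \<psi> (Suc t) = \<psi> t v* M t" "\<And>t i. t \<le> N \<Longrightarrow> 0 \<le> \<psi> t $ i"
    by blast
  have "\<phi> 0 = initial_from_terminal (matrix_chain_prod M N) q b"
    using chain_backward[of N \<phi> M N, OF \<phi>(1)] by (simp add: \<phi>N initial_from_terminal_def)
  moreover have "\<psi> N = terminal_from_initial (matrix_chain_prod M N) p a"
    using chain_forward[of N \<psi> M N, OF \<psi>(1)] by (simp add: \<psi>0 terminal_from_initial_def)
  ultimately have ends: "\<phi> 0 = a" "\<psi> N = b"
    using static by (metis, metis)
  have "a $ x * \<psi> 0 $ x = p $ x" for x
    using a[of x] by (simp add: \<psi>0)
  moreover have "(\<phi> N $ x)\<^sup>2 * b $ x = q $ x" for x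
    using b[of x] q[of x] by (simp add: \<phi>N)
  moreover have "\<phi> t $ i = (\<Sum>j\<in>UNIV. M t $ i $ j * \<phi> (Suc t) $ j)" if "t < N" for t i
    using arg_cong[OF \<phi>(1)[OF that], of "\<lambda>v. v $ i"] by (simp add: matrix_vector_mult_def)
  moreover have "\<psi> (Suc t) $ j = (\<Sum>i\<in>UNIV. M t $ i $ j * \<psi> t $ i)" if "t < N" for t j
    using arg_cong[OF \<psi>(1)[OF that], of "\<lambda>v. v $ j"]
    by (simp add: vector_matrix_mult_def mult.commute)
  ultimately show ?dynamic
    using ends \<phi>(2) \<psi>(2) by (intro exI[of _ \<phi>] exI[of _ \<psi>]) simp
qed

section \<open>The dynamic system\<close>

lemma pmf_vector_nonzero:
  fixes P :: "'n::finite pmf"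
  shows "(\<chi> x. pmf P x) \<noteq> 0"
  using set_pmf_not_empty[of P] by (auto simp: vec_eq_iff set_pmf_iff)

theorem theorem11:
  fixes E :: "('n::finite \<times> 'n) set"
    and M :: "nat \<Rightarrow> real^'n^'n"
    and N :: nat
    and \<nu>\<^sub>0 \<nu>\<^sub>N :: "'n pmf"
  assumes "strongly_connected_graph E"
    and "aperiodic_graph E"
    and "N \<ge> 1"
    and "\<And>t i j. t < N \<Longrightarrow> 0 \<le> M t $ i $ j"
    and "\<And>t i j. t < N \<Longrightarrow> (i, j) \<notin> E \<Longrightarrow> M t $ i $ j = 0"
    and "\<And>i j. 0 < matrix_chain_prod M N $ i $ j"
  shows "\<exists>!(a, b).
    (\<forall>i. 0 < a $ i) \<and> (\<forall>j. 0 < b $ j) \<and>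
    (\<exists>\<phi> \<psi> :: nat \<Rightarrow> real^'n.
      \<phi> 0 = a \<and> \<psi> N = b \<and>
      (\<forall>t\<le>N. \<forall>i. 0 \<le> \<phi> t $ i \<and> 0 \<le> \<psi> t $ i) \<and>
      (\<forall>t<N. \<forall>i. \<phi> t $ i = (\<Sum>j\<in>UNIV. M t $ i $ j * \<phi> (Suc t) $ j)) \<and>
      (\<forall>t<N. \<forall>j. \<psi> (Suc t) $ j = (\<Sum>i\<in>UNIV. M t $ i $ j * \<psi> t $ i)) \<and>
      (\<forall>x. \<phi> 0 $ x * \<psi> 0 $ x = pmf \<nu>\<^sub>0 x) \<and>
      (\<forall>x. (\<phi> N $ x)\<^sup>2 * \<psi> N $ x = pmf \<nu>\<^sub>N x))"
    (is "\<exists>!(a, b). ?pos a \<and> ?pos b \<and> ?dynamic a b")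
proof -
  define p q where "p = (\<chi> x. pmf \<nu>\<^sub>0 x)" and "q = (\<chi> x. pmf \<nu>\<^sub>N x)"
  let ?G = "matrix_chain_prod M N"
  have p: "\<And>i. 0 \<le> p $ i" "p \<noteq> 0" and q: "\<And>i. 0 \<le> q $ i" "q \<noteq> 0"
    by (simp_all add: p_def q_def pmf_vector_nonzero)
  have "?dynamic a b \<longleftrightarrow> a = initial_from_terminal ?G q b \<and> b = terminal_from_initial ?G p a"
    if "?pos a" "?pos b" for a b
    using schroedinger_boundary_reduction[of N M p q a b] assms(4) p(1) q(1) that
    by (simp add: p_def q_def)
  then have "(\<lambda>(a, b). ?pos a \<and> ?pos b \<and> ?dynamic a b) = (\<lambda>(a, b). ?pos a \<and> ?pos b \<and>
      a = initial_from_terminal ?G q b \<and> b = terminal_from_initial ?G p a)"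
    by (intro ext) (auto split: prod.split)
  then show ?thesis
    using static_schroedinger_system[of ?G p q] assms(6) p q by simp
qed

end
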